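(* Let $\mathcal P$ be a non-empty set of probability measures on some measurable space $(\Omega,\mathcal A)$ and let $\theta:\mathcal P\to\mathbb R$ be a functional. If $\mathcal P$ is convex and $\theta$ is linear (i.e. $\theta(\lambda P_0+(1-\lambda)P_1)=\lambda\theta(P_0)+(1-\lambda)\theta(P_1)$ for $P_0,P_1\in\mathcal P$, $\lambda\in[0,1]$) and non-constant, then there exist constants $c_0,c_1>0$ such that $\omega_{TV}(\varepsilon)\ge c_0\varepsilon$ and $\omega_H(\varepsilon)\ge\frac{c_0}{2}\varepsilon^2$ for all $\varepsilon\in[0,c_1]$.
   Context: $d_{TV}(P_0,P_1)=\sup_A|P_0(A)-P_1(A)|$ and $d_H(P_0,P_1)=\big(\int(\sqrt{p_0}-\sqrt{p_1})^2d\mu\big)^{1/2}$ with densities $p_j$ with respect to a dominating $\mu$. $\omega_{TV}(\varepsilon)=\sup\{|\theta(P_0)-\theta(P_1)|:d_{TV}(P_0,P_1)\le\varepsilon,\ P_0,P_1\in\mathcal P\}$, and $\omega_H(\varepsilon)$ is defined likewise with $d_H$. *)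

theory Defs
  imports "HOL-Probability.Probability"
begin

text \<open>
  A measurable space \<open>(\<Omega>, \<A>)\<close> is represented by any measure \<open>M\<close> with
  \<open>space M = \<Omega>\<close> and \<open>sets M = \<A>\<close>; the probability measures on it are the elements of
  \<open>space (prob_algebra M)\<close>.
\<close>

definition mixture :: "real \<Rightarrow> 'a measure \<Rightarrow> 'a measure \<Rightarrow> 'a measure" where
  "mixture l P0 P1 = measure_of (space P0) (sets P0)
     (\<lambda>A. ennreal l * emeasure P0 A + ennreal (1 - l) * emeasure P1 A)"

lemma space_mixture [simp]: "space (mixture l P0 P1) = space P0"
  and sets_mixture [simp]: "sets (mixture l P0 P1) = sets P0"
  by (simp_all add: mixture_def)

lemma emeasure_mixture:
  assumes "sets P1 = sets P0" "A \<in> sets P0"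
  shows "emeasure (mixture l P0 P1) A =
    ennreal l * emeasure P0 A + ennreal (1 - l) * emeasure P1 A"
  unfolding mixture_def
proof (rule emeasure_measure_of_sigma)
  show "sigma_algebra (space P0) (sets P0)" ..
  show "positive (sets P0)
      (\<lambda>A. ennreal l * emeasure P0 A + ennreal (1 - l) * emeasure P1 A)"
    by (simp add: positive_def)
  show "countably_additive (sets P0)
      (\<lambda>A. ennreal l * emeasure P0 A + ennreal (1 - l) * emeasure P1 A)"
  proof (rule countably_additiveI)
    fix B :: "nat \<Rightarrow> 'a set"
    assume B: "range B \<subseteq> sets P0" "disjoint_family B"
    have "(\<Sum>i. ennreal l * emeasure P0 (B i) + ennreal (1 - l) * emeasure P1 (B i))
      = (\<Sum>i. ennreal l * emeasure P0 (B i)) + (\<Sum>i. ennreal (1 - l) * emeasure P1 (B i))"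
      by (intro suminf_add[symmetric]) auto
    also have "\<dots> = ennreal l * (\<Sum>i. emeasure P0 (B i))
        + ennreal (1 - l) * (\<Sum>i. emeasure P1 (B i))"
      by simp
    also have "\<dots> = ennreal l * emeasure P0 (\<Union>i. B i)
        + ennreal (1 - l) * emeasure P1 (\<Union>i. B i)"
      using B assms(1) by (simp add: suminf_emeasure)
    finally show "(\<Sum>i. ennreal l * emeasure P0 (B i) + ennreal (1 - l) * emeasure P1 (B i))
      = ennreal l * emeasure P0 (\<Union>i. B i) + ennreal (1 - l) * emeasure P1 (\<Union>i. B i)" .
  qed
qed fact

lemma mixture_in_prob_algebra:
  assumes "P0 \<in> space (prob_algebra M)" "P1 \<in> space (prob_algebra M)" "l \<in> {0..1}"
  shows "mixture l P0 P1 \<in> space (prob_algebra M)"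
proof -
  interpret P0: prob_space P0 using assms(1) by (simp add: space_prob_algebra)
  interpret P1: prob_space P1 using assms(2) by (simp add: space_prob_algebra)
  have eq: "sets P1 = sets P0"
    using assms by (simp add: space_prob_algebra)
  then have sp: "space P1 = space P0" by (rule sets_eq_imp_space_eq)
  have "emeasure (mixture l P0 P1) (space (mixture l P0 P1)) = 1"
    using P0.emeasure_space_1 P1.emeasure_space_1 assms(3)
    by (simp add: emeasure_mixture[OF eq] sp ennreal_plus[symmetric] del: ennreal_plus)
  then show ?thesis
    using assms(1) by (auto simp: space_prob_algebra intro: prob_spaceI)
qed

definition convex_family :: "'a measure set \<Rightarrow> bool" where
  "convex_family \<P> \<longleftrightarrow> (\<forall>P0\<in>\<P>. \<forall>P1\<in>\<P>. \<forall>l\<in>{0..1}. mixture l P0 P1 \<in> \<P>)"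

definition linear_functional_on :: "'a measure set \<Rightarrow> ('a measure \<Rightarrow> real) \<Rightarrow> bool" where
  "linear_functional_on \<P> \<theta> \<longleftrightarrow>
     (\<forall>P0\<in>\<P>. \<forall>P1\<in>\<P>. \<forall>l\<in>{0..1}. \<theta> (mixture l P0 P1) = l * \<theta> P0 + (1 - l) * \<theta> P1)"

definition d_TV :: "'a measure \<Rightarrow> 'a measure \<Rightarrow> real" where
  "d_TV P0 P1 = (SUP A\<in>sets P0. \<bar>measure P0 A - measure P1 A\<bar>)"

text \<open>
  The Hellinger distance is defined through the dominating measure \<open>(P0 + P1) / 2\<close>; lemma
  \<open>d_H_eq\<close> shows that every other dominating measure and choice of densities yields the
  same value.
\<close>

definition d_H :: "'a measure \<Rightarrow> 'a measure \<Rightarrow> real" where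
  "d_H P0 P1 = (let \<mu> = mixture (1 / 2) P0 P1 in
     sqrt (\<integral>x. (sqrt (enn2real (RN_deriv \<mu> P0 x)) - sqrt (enn2real (RN_deriv \<mu> P1 x)))\<^sup>2 \<partial>\<mu>))"

lemma d_H_eq:
  fixes p0 p1 :: "'a \<Rightarrow> real"
  assumes prob: "prob_space P0" "prob_space P1"
    and p [measurable]: "p0 \<in> borel_measurable \<mu>" "p1 \<in> borel_measurable \<mu>"
    and nonneg: "\<And>x. 0 \<le> p0 x" "\<And>x. 0 \<le> p1 x"
    and dens: "P0 = density \<mu> p0" "P1 = density \<mu> p1"
  shows "d_H P0 P1 = sqrt (\<integral>x. (sqrt (p0 x) - sqrt (p1 x))\<^sup>2 \<partial>\<mu>)"
proof -
  define S where "S = mixture (1 / 2) P0 P1"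
  define s where "s x = (p0 x + p1 x) / 2" for x
  have s [measurable]: "s \<in> borel_measurable \<mu>" unfolding s_def by measurable
  have s0: "0 \<le> s x" for x using nonneg by (simp add: s_def)
  have sets: "sets P0 = sets \<mu>" "sets P1 = sets \<mu>" using dens by auto
  have S_dens: "S = density \<mu> s"
  proof (rule measure_eqI)
    show "sets S = sets (density \<mu> s)" using sets by (simp add: S_def)
    fix A assume "A \<in> sets S"
    then have A [measurable]: "A \<in> sets \<mu>" using sets by (simp add: S_def)
    have *: "ennreal (s x) = ennreal (1/2) * ennreal (p0 x) + ennreal (1/2) * ennreal (p1 x)" for x
      unfolding s_def using nonneg[of x]
      by (simp only: ennreal_mult[symmetric] ennreal_plus[symmetric] mult_nonneg_nonneg
          zero_le_divide_1_iff zero_le_numeral) (simp add: field_simps)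
    have "emeasure (density \<mu> s) A
      = (\<integral>\<^sup>+x. ennreal (1/2) * (ennreal (p0 x) * indicator A x)
             + ennreal (1/2) * (ennreal (p1 x) * indicator A x) \<partial>\<mu>)"
      by (subst emeasure_density) (measurable, simp only: * distrib_right mult.assoc)
    also have "\<dots> = ennreal (1/2) * emeasure P0 A + ennreal (1/2) * emeasure P1 A"
      unfolding dens by (simp add: nn_integral_add nn_integral_cmult emeasure_density)
    also have "\<dots> = emeasure S A"
      using sets unfolding S_def by (subst emeasure_mixture) (auto simp: field_simps)
    finally show "emeasure S A = emeasure (density \<mu> s) A" by simp
  qed
  have "S \<in> space (prob_algebra \<mu>)"
    unfolding S_def using prob sets
    by (intro mixture_in_prob_algebra) (auto simp: space_prob_algebra)
  then interpret S: prob_space S by (simp add: space_prob_algebra)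
  have key: "AE x in \<mu>. p x = s x * enn2real (RN_deriv S P x)"
    if P: "prob_space P" "P = density \<mu> p" "p \<in> borel_measurable \<mu>"
      "\<And>x. 0 \<le> p x" "\<And>x. p x \<le> 2 * s x" for P and p :: "'a \<Rightarrow> real"
  proof -
    have [measurable]: "p \<in> borel_measurable \<mu>" by fact
    interpret P: prob_space P by fact
    have ac: "absolutely_continuous S P"
      unfolding absolutely_continuous_def
    proof
      fix A assume "A \<in> null_sets S"
      then have A: "A \<in> sets \<mu>" "AE x in \<mu>. x \<in> A \<longrightarrow> ennreal (s x) \<le> 0"
        unfolding S_dens by (auto simp: null_sets_density_iff)
      from A(2) have "AE x in \<mu>. x \<in> A \<longrightarrow> ennreal (p x) = 0"
      proof eventually_elim
        case (elim x)
        then show ?case using P(4)[of x] P(5)[of x] by (auto simp: ennreal_eq_0_iff)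
      qed
      with A(1) show "A \<in> null_sets P" unfolding P(2) by (auto simp: null_sets_density_iff)
    qed
    have r [measurable]: "RN_deriv S P \<in> borel_measurable \<mu>"
      using borel_measurable_RN_deriv[of S P] by (simp add: S_dens)
    have "P = density S (RN_deriv S P)"
      using S.density_RN_deriv[OF ac] P(2) by (simp add: S_dens)
    also have "\<dots> = density \<mu> (\<lambda>x. ennreal (s x) * RN_deriv S P x)"
      by (subst (1) S_dens, subst density_density_eq) auto
    finally have "density \<mu> p = density \<mu> (\<lambda>x. ennreal (s x) * RN_deriv S P x)"
      using P(2) by simp
    moreover have "emeasure (density \<mu> p) (space \<mu>) = (\<integral>\<^sup>+x. ennreal (p x) \<partial>\<mu>)"
      by (subst emeasure_density) (auto intro!: nn_integral_cong)
    then have "(\<integral>\<^sup>+x. ennreal (p x) \<partial>\<mu>) \<noteq> \<infinity>"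
      using P.emeasure_space_1 P(2) by simp
    ultimately have "AE x in \<mu>. ennreal (p x) = ennreal (s x) * RN_deriv S P x"
      by (subst (asm) finite_density_unique) auto
    then show ?thesis
    proof eventually_elim
      case (elim x)
      then have "enn2real (ennreal (p x)) = enn2real (ennreal (s x) * RN_deriv S P x)" by simp
      then show ?case using P(4) s0 by (simp add: enn2real_mult)
    qed
  qed
  have "AE x in \<mu>. p0 x = s x * enn2real (RN_deriv S P0 x)"
    using nonneg by (intro key prob dens p) (auto simp: s_def)
  moreover have "AE x in \<mu>. p1 x = s x * enn2real (RN_deriv S P1 x)"
    using nonneg by (intro key prob dens p) (auto simp: s_def)
  ultimately have ae: "AE x in \<mu>. s x *\<^sub>R (sqrt (enn2real (RN_deriv S P0 x))
      - sqrt (enn2real (RN_deriv S P1 x)))\<^sup>2 = (sqrt (p0 x) - sqrt (p1 x))\<^sup>2"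
  proof eventually_elim
    case (elim x)
    have *: "sqrt (p0 x) = sqrt (s x) * sqrt (enn2real (RN_deriv S P0 x))"
      "sqrt (p1 x) = sqrt (s x) * sqrt (enn2real (RN_deriv S P1 x))"
      by (subst elim(1), simp add: real_sqrt_mult) (subst elim(2), simp add: real_sqrt_mult)
    show ?case unfolding * right_diff_distrib[symmetric] power_mult_distrib
      using s0[of x] by simp
  qed
  have [measurable]: "RN_deriv S Q \<in> borel_measurable \<mu>" for Q
    using borel_measurable_RN_deriv[of S Q] by (simp add: S_dens)
  have int_S: "(\<integral>x. f x \<partial>S) = (\<integral>x. s x *\<^sub>R f x \<partial>\<mu>)"
    if [measurable]: "f \<in> borel_measurable \<mu>" for f :: "'a \<Rightarrow> real"
    unfolding S_dens by (rule integral_density) (auto simp: s0)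
  have "(\<integral>x. (sqrt (enn2real (RN_deriv S P0 x)) - sqrt (enn2real (RN_deriv S P1 x)))\<^sup>2 \<partial>S)
    = (\<integral>x. s x *\<^sub>R (sqrt (enn2real (RN_deriv S P0 x))
        - sqrt (enn2real (RN_deriv S P1 x)))\<^sup>2 \<partial>\<mu>)"
    by (rule int_S) measurable
  also have "\<dots> = (\<integral>x. (sqrt (p0 x) - sqrt (p1 x))\<^sup>2 \<partial>\<mu>)"
    by (rule integral_cong_AE) (use ae in auto)
  finally show ?thesis by (simp add: d_H_def S_def Let_def)
qed

text \<open>
  The supremum may be infinite when \<open>\<theta>\<close> is unbounded, so the modulus is extended-real valued.
\<close>

definition modulus ::
  "('a measure \<Rightarrow> 'a measure \<Rightarrow> real) \<Rightarrow> 'a measure set \<Rightarrow> ('a measure \<Rightarrow> real) \<Rightarrow> real \<Rightarrow> ereal" where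
  "modulus d \<P> \<theta> \<epsilon> =
     Sup {ereal \<bar>\<theta> P0 - \<theta> P1\<bar> | P0 P1. d P0 P1 \<le> \<epsilon> \<and> P0 \<in> \<P> \<and> P1 \<in> \<P>}"

abbreviation "\<omega>_TV \<equiv> modulus d_TV"
abbreviation "\<omega>_H \<equiv> modulus d_H"

end

theory Submission
  imports Defs
begin

text \<open>
  Fix \<open>P0, P1 \<in> \<P>\<close> with \<open>D = \<bar>\<theta> P1 - \<theta> P0\<bar> > 0\<close> and move from \<open>P0\<close> to the mixture
  \<open>Q = l P1 + (1 - l) P0\<close>. By linearity \<open>\<bar>\<theta> Q - \<theta> P0\<bar> = l D\<close>, whereas the total variation distance
  of \<open>Q\<close> and \<open>P0\<close> is at most \<open>l\<close> and their Hellinger distance is at most \<open>sqrt (2 l)\<close>. Taking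
  \<open>l = \<epsilon>\<close> and \<open>l = \<epsilon>\<^sup>2 / 2\<close>, respectively, gives both bounds with \<open>c0 = D\<close> and \<open>c1 = 1\<close>.
\<close>

lemma measure_mixture:
  assumes "finite_measure P" "finite_measure Q" "sets Q = sets P" "A \<in> sets P" "l \<in> {0..1}"
  shows "measure (mixture l P Q) A = l * measure P A + (1 - l) * measure Q A"
proof -
  interpret P: finite_measure P by fact
  interpret Q: finite_measure Q by fact
  have "emeasure (mixture l P Q) A = ennreal (l * measure P A + (1 - l) * measure Q A)"
    using assms
    by (simp add: emeasure_mixture P.emeasure_eq_measure Q.emeasure_eq_measure
        ennreal_mult ennreal_plus)
  then show ?thesis
    using assms(5) by (auto intro!: measure_eq_emeasure_eq_ennreal)
qed

text \<open>On each event the mixture differs from \<open>Q\<close> by exactly \<open>l\<close>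
  times the difference of \<open>P\<close> and \<open>Q\<close>, and two probabilities differ by at
  most 1.\<close>

lemma d_TV_mixture_le:
  assumes "prob_space P" "prob_space Q" "sets Q = sets P" "l \<in> {0..1}"
  shows "d_TV (mixture l P Q) Q \<le> l"
  unfolding d_TV_def
proof (rule cSUP_least)
  interpret P: prob_space P by fact
  interpret Q: prob_space Q by fact
  show "sets (mixture l P Q) \<noteq> {}"
    by auto
  fix A assume "A \<in> sets (mixture l P Q)"
  then have "measure (mixture l P Q) A - measure Q A = l * (measure P A - measure Q A)"
    using assms by (simp add: measure_mixture P.finite_measure_axioms Q.finite_measure_axioms
        algebra_simps)
  moreover have "\<bar>measure P A - measure Q A\<bar> \<le> 1"
    using P.prob_le_1[of A] Q.prob_le_1[of A] measure_nonneg[of P A] measure_nonneg[of Q A]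
    by linarith
  ultimately show "\<bar>measure (mixture l P Q) A - measure Q A\<bar> \<le> l"
    using assms(4) by (simp add: abs_mult mult_left_le)
qed

text \<open>A measure dominating both components also dominates the mixture, so
  \<open>d_H_eq\<close> can compare the mixture with \<open>Q\<close> through explicit
  densities.\<close>

lemma mixture_density:
  fixes p q :: "'a \<Rightarrow> real"
  assumes [measurable]: "p \<in> borel_measurable \<mu>" "q \<in> borel_measurable \<mu>"
    and nonneg: "\<And>x. 0 \<le> p x" "\<And>x. 0 \<le> q x" and l: "l \<in> {0..1}"
  shows "mixture l (density \<mu> p) (density \<mu> q) = density \<mu> (\<lambda>x. l * p x + (1 - l) * q x)"
proof (rule measure_eqI)
  fix A assume "A \<in> sets (mixture l (density \<mu> p) (density \<mu> q))"
  then have [measurable]: "A \<in> sets \<mu>" by simp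
  have *: "ennreal (l * p x + (1 - l) * q x) = ennreal l * ennreal (p x) + ennreal (1 - l) * ennreal (q x)" for x
    using nonneg l by (simp add: ennreal_mult ennreal_plus)
  have "emeasure (density \<mu> (\<lambda>x. l * p x + (1 - l) * q x)) A
    = (\<integral>\<^sup>+x. ennreal l * (ennreal (p x) * indicator A x)
           + ennreal (1 - l) * (ennreal (q x) * indicator A x) \<partial>\<mu>)"
    by (subst emeasure_density) (measurable, simp only: * distrib_right mult.assoc)
  also have "\<dots> = ennreal l * emeasure (density \<mu> p) A + ennreal (1 - l) * emeasure (density \<mu> q) A"
    by (simp add: nn_integral_add nn_integral_cmult emeasure_density)
  finally show "emeasure (mixture l (density \<mu> p) (density \<mu> q)) A
      = emeasure (density \<mu> (\<lambda>x. l * p x + (1 - l) * q x)) A"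
    by (simp add: emeasure_mixture)
qed simp

text \<open>One factor \<open>\<bar>sqrt a - sqrt b\<bar>\<close> is enlarged to
  \<open>sqrt a + sqrt b\<close>, and the product telescopes to a difference of squares. This bounds
  the Hellinger integrand by the L1 integrand pointwise.\<close>

lemma power2_sqrt_diff_le:
  fixes a b :: real
  assumes "0 \<le> a" "0 \<le> b"
  shows "(sqrt a - sqrt b)\<^sup>2 \<le> \<bar>a - b\<bar>"
proof -
  have "(sqrt a - sqrt b)\<^sup>2 = \<bar>sqrt a - sqrt b\<bar> * \<bar>sqrt a - sqrt b\<bar>"
    by (simp add: power2_eq_square)
  also have "\<dots> \<le> \<bar>sqrt a - sqrt b\<bar> * \<bar>sqrt a + sqrt b\<bar>"
    using assms real_sqrt_ge_zero[of a] real_sqrt_ge_zero[of b]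
    by (intro mult_left_mono) linarith+
  also have "\<dots> = \<bar>(sqrt a)\<^sup>2 - (sqrt b)\<^sup>2\<bar>"
    by (simp only: power2_eq_square square_diff_square_factored abs_mult mult.commute)
  also have "\<dots> = \<bar>a - b\<bar>"
    using assms by simp
  finally show ?thesis .
qed

text \<open>The even mixture dominates both measures, so Radon-Nikodym applies. The densities are
  real and nonnegative everywhere, the form that \<open>d_H_eq\<close> expects.\<close>

lemma obtain_common_density:
  assumes P: "prob_space P" and Q: "prob_space Q" and eq: "sets Q = sets P"
  obtains \<mu> and p q :: "'a \<Rightarrow> real"
  where "p \<in> borel_measurable \<mu>" "q \<in> borel_measurable \<mu>"
    and "\<And>x. 0 \<le> p x" "\<And>x. 0 \<le> q x"
    and "P = density \<mu> p" "Q = density \<mu> q"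
proof -
  define \<mu> where "\<mu> = mixture (1 / 2) P Q"
  have "\<mu> \<in> space (prob_algebra P)"
    unfolding \<mu>_def using assms by (intro mixture_in_prob_algebra) (auto simp: space_prob_algebra)
  then interpret \<mu>: prob_space \<mu> by (simp add: space_prob_algebra)
  have dens: "\<exists>r :: 'a \<Rightarrow> real. r \<in> borel_measurable \<mu> \<and> (\<forall>x. 0 \<le> r x) \<and> R = density \<mu> (\<lambda>x. ennreal (r x))"
    if R: "prob_space R" "sets R = sets \<mu>" "absolutely_continuous \<mu> R" for R
  proof -
    interpret R: prob_space R by fact
    obtain r :: "'a \<Rightarrow> real" where r: "r \<in> borel_measurable \<mu>" "\<And>x. 0 \<le> r x"
      "AE x in \<mu>. RN_deriv \<mu> R x = ennreal (r x)"
      using \<mu>.real_RN_deriv[OF R.finite_measure_axioms R(3,2)] by blast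
    \<comment> \<open>Passing from the extended-valued derivative to the real \<open>r\<close>
      changes it only on a null set, hence leaves the measure unchanged.\<close>
    have "density \<mu> r = density \<mu> (RN_deriv \<mu> R)"
      using r(1,3) by (intro density_cong) auto
    then have "R = density \<mu> r"
      using \<mu>.density_RN_deriv[OF R(3,2)] by simp
    then show ?thesis
      using r(1,2) by blast
  qed
  \<comment> \<open>Both weights equal 1/2 > 0, so a vanishing weighted sum forces both masses to
    vanish.\<close>
  have null: "emeasure P A = 0 \<and> emeasure Q A = 0" if "A \<in> null_sets \<mu>" for A
    using that eq by (auto simp: \<mu>_def null_sets_def emeasure_mixture ennreal_eq_0_iff)
  have "absolutely_continuous \<mu> P" "absolutely_continuous \<mu> Q"
    using null eq by (auto simp: absolutely_continuous_def null_sets_def \<mu>_def)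
  moreover have "sets P = sets \<mu>" "sets Q = sets \<mu>"
    using eq by (simp_all add: \<mu>_def)
  ultimately show thesis
    using dens[OF P] dens[OF Q] that by blast
qed

lemma has_integral_prob_density:
  fixes p :: "'a \<Rightarrow> real"
  assumes "prob_space (density \<mu> p)" "p \<in> borel_measurable \<mu>" "\<And>x. 0 \<le> p x"
  shows "has_bochner_integral \<mu> p 1"
proof (rule has_bochner_integral_nn_integral)
  have "(\<integral>\<^sup>+x. ennreal (p x) \<partial>\<mu>) = emeasure (density \<mu> p) (space \<mu>)"
    using assms(2) by (subst emeasure_density) (auto intro!: nn_integral_cong)
  then show "(\<integral>\<^sup>+x. ennreal (p x) \<partial>\<mu>) = ennreal 1"
    using prob_space.emeasure_space_1[OF assms(1)] by simp
qed (use assms in auto)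

text \<open>With densities \<open>m\<close>, \<open>p\<close>, \<open>q\<close> of the mixture,
  \<open>P\<close> and \<open>Q\<close>, the squared distance is at most the integral of
  \<open>\<bar>m - q\<bar> = l * \<bar>p - q\<bar>\<close>, hence at most that of
  \<open>l * (p + q)\<close>, which is \<open>2 * l\<close>.\<close>

lemma d_H_mixture_le:
  assumes P: "prob_space P" and Q: "prob_space Q" and eq: "sets Q = sets P" and l: "l \<in> {0..1}"
  shows "d_H (mixture l P Q) Q \<le> sqrt (2 * l)"
proof -
  obtain \<mu> and p q :: "'a \<Rightarrow> real"
    where [measurable]: "p \<in> borel_measurable \<mu>" "q \<in> borel_measurable \<mu>"
      and nonneg: "\<And>x. 0 \<le> p x" "\<And>x. 0 \<le> q x"
      and dens: "P = density \<mu> p" "Q = density \<mu> q"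
    using obtain_common_density[OF P Q eq] by metis
  define m where "m x = l * p x + (1 - l) * q x" for x
  have [measurable]: "m \<in> borel_measurable \<mu>" unfolding m_def by measurable
  have m0: "0 \<le> m x" for x using nonneg l by (simp add: m_def)
  have "mixture l P Q \<in> space (prob_algebra P)"
    using assms by (intro mixture_in_prob_algebra) (auto simp: space_prob_algebra)
  then have "prob_space (mixture l P Q)" by (simp add: space_prob_algebra)
  then have "d_H (mixture l P Q) Q = sqrt (\<integral>x. (sqrt (m x) - sqrt (q x))\<^sup>2 \<partial>\<mu>)"
    using Q dens mixture_density[of p \<mu> q l] nonneg l m0
    by (intro d_H_eq) (auto simp: m_def)
  also have "\<dots> \<le> sqrt (2 * l)"
  proof (rule real_sqrt_le_mono)
    have pq: "has_bochner_integral \<mu> p 1" "has_bochner_integral \<mu> q 1"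
      using P Q nonneg unfolding dens by (intro has_integral_prob_density; simp)+
    have bd: "has_bochner_integral \<mu> (\<lambda>x. l * (p x + q x)) (l * (1 + 1))"
      by (intro has_bochner_integral_mult_right has_bochner_integral_add pq)
    have "(sqrt (m x) - sqrt (q x))\<^sup>2 \<le> l * (p x + q x)" for x
    proof -
      have "m x - q x = l * (p x - q x)" by (simp add: m_def algebra_simps)
      then have "\<bar>m x - q x\<bar> = l * \<bar>p x - q x\<bar>" using l by (simp add: abs_mult)
      also have "\<dots> \<le> l * (p x + q x)"
        using l nonneg[of x] by (intro mult_left_mono) auto
      finally show ?thesis using power2_sqrt_diff_le[OF m0 nonneg(2)] by (rule order_trans[rotated])
    qed
    \<comment> \<open>Integrability of the nonnegative upper bound suffices here: a non-integrable
      left side would have integral 0 by convention.\<close>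
    then have "(\<integral>x. (sqrt (m x) - sqrt (q x))\<^sup>2 \<partial>\<mu>) \<le> (\<integral>x. l * (p x + q x) \<partial>\<mu>)"
      using bd l nonneg
      by (intro integral_mono') (auto simp: has_bochner_integral_iff)
    also have "\<dots> = 2 * l"
      using bd by (simp add: has_bochner_integral_iff)
    finally show "(\<integral>x. (sqrt (m x) - sqrt (q x))\<^sup>2 \<partial>\<mu>) \<le> 2 * l" .
  qed
  finally show ?thesis .
qed

lemma modulus_upper:
  assumes "P0 \<in> \<P>" "P1 \<in> \<P>" "d P0 P1 \<le> \<epsilon>"
  shows "ereal \<bar>\<theta> P0 - \<theta> P1\<bar> \<le> modulus d \<P> \<theta> \<epsilon>"
  unfolding modulus_def using assms by (intro Sup_upper) blast

theorem lemmaH2: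
  fixes M :: "'a measure" and \<P> :: "'a measure set" and \<theta> :: "'a measure \<Rightarrow> real"
  assumes "\<P> \<noteq> {}" and "\<P> \<subseteq> space (prob_algebra M)"
    and "convex_family \<P>" and "linear_functional_on \<P> \<theta>"
    and "\<not> \<theta> constant_on \<P>"
  shows "\<exists>c0 c1 :: real. c0 > 0 \<and> c1 > 0 \<and>
    (\<forall>\<epsilon>\<in>{0..c1}. \<omega>_TV \<P> \<theta> \<epsilon> \<ge> ereal (c0 * \<epsilon>) \<and> \<omega>_H \<P> \<theta> \<epsilon> \<ge> ereal (c0 / 2 * \<epsilon>\<^sup>2))"
proof -
  \<comment> \<open>\<open>Q\<close> is the fixed base point and \<open>P\<close> the endpoint
    towards which the mixtures move; non-constancy makes their values differ.\<close>
  obtain P Q where PQ: "P \<in> \<P>" "Q \<in> \<P>" "\<theta> P \<noteq> \<theta> Q"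
    using assms(5) unfolding constant_on_def by metis
  have prob: "prob_space P" "prob_space Q" "sets Q = sets P"
    using PQ assms(2) by (auto simp: space_prob_algebra)
  define D where "D = \<bar>\<theta> P - \<theta> Q\<bar>"
  have mix: "mixture l P Q \<in> \<P>" "\<bar>\<theta> (mixture l P Q) - \<theta> Q\<bar> = D * l" if "l \<in> {0..1}" for l
  proof -
    show "mixture l P Q \<in> \<P>"
      using assms(3) PQ that by (auto simp: convex_family_def)
    have "\<theta> (mixture l P Q) - \<theta> Q = (\<theta> P - \<theta> Q) * l"
      using assms(4) PQ that by (simp add: linear_functional_on_def algebra_simps)
    then show "\<bar>\<theta> (mixture l P Q) - \<theta> Q\<bar> = D * l"
      using that by (simp add: D_def abs_mult)
  qed
  have "ereal (D * \<epsilon>) \<le> \<omega>_TV \<P> \<theta> \<epsilon> \<and> ereal (D / 2 * \<epsilon>\<^sup>2) \<le> \<omega>_H \<P> \<theta> \<epsilon>" if \<epsilon>: "\<epsilon> \<in> {0..1}" for \<epsilon>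
  proof
    show "ereal (D * \<epsilon>) \<le> \<omega>_TV \<P> \<theta> \<epsilon>"
      using modulus_upper[where d = d_TV, OF mix(1)[OF \<epsilon>] PQ(2) d_TV_mixture_le[OF prob \<epsilon>], of \<theta>]
        mix(2)[OF \<epsilon>] by simp
    \<comment> \<open>This weight solves \<open>sqrt (2 * l) = \<epsilon>\<close>; the bound
      \<epsilon> \<le> 1 keeps it, like the weight \<epsilon> used for total variation, inside the
      unit interval.\<close>
    have l: "\<epsilon>\<^sup>2 / 2 \<in> {0..1}"
      using \<epsilon> power_le_one[of \<epsilon> 2] by auto
    have "d_H (mixture (\<epsilon>\<^sup>2 / 2) P Q) Q \<le> \<epsilon>"
      using d_H_mixture_le[OF prob l] \<epsilon> by simp
    from modulus_upper[where d = d_H, OF mix(1)[OF l] PQ(2) this, of \<theta>]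
    show "ereal (D / 2 * \<epsilon>\<^sup>2) \<le> \<omega>_H \<P> \<theta> \<epsilon>"
      using mix(2)[OF l] by simp
  qed
  moreover have "D > 0"
    using PQ(3) by (simp add: D_def)
  ultimately show ?thesis
    by (intro exI[of _ D] exI[of _ 1]) auto
qed

end
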